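(* Let $\alpha\le\beta$ be positive integers with $\gcd(\alpha,\beta)=1$ and $\alpha\beta=2^{\nu}\mho$, where $\nu\in\{0,1,2,3\}$ and $\mho$ is an odd squarefree positive integer. Let $m_S=\dim S_4(\Gamma_0(\alpha\beta))\in\mathbb{N}$, let $\mathcal{B}_E=\{M(q^t): t\mid\alpha\beta\}$, and let $\mathcal{B}_S=\{\mathfrak{B}_1(q),\dots,\mathfrak{B}_{m_S}(q)\}$ be a set of eta quotients $\mathfrak{B}_j(q)=\prod_{\delta\mid\alpha\beta}\eta(\delta z)^{r(j,\delta)}\in S_4(\Gamma_0(\alpha\beta))$, $r(j,\delta)\in\mathbb{Z}$, such that $\mathcal{B}_E\cup\mathcal{B}_S$ is a basis of $M_4(\Gamma_0(\alpha\beta))$. Write $\mathfrak{B}_j(q)=\sum_{n\ge1}\mathfrak{b}_j(n)q^n$. Let $X_\delta\in\mathbb{C}$ ($\delta\mid\alpha\beta$) and $Y_j\in\mathbb{C}$ ($1\le j\le m_S$) be the values determined by $$(\alpha L(q^{\alpha})-\beta L(q^{\beta}))^{2}=\sum_{\delta\mid\alpha\beta}X_\delta+\sum_{n=1}^{\infty}\Bigl(240\sum_{\delta\mid\alpha\beta}\sigma_3\bigl(\tfrac n\delta\bigr)X_\delta+\sum_{j=1}^{m_S}\mathfrak{b}_j(n)Y_j\Bigr)q^n .$$ Then for every positive integer $n$, $$W_{(\alpha,\beta)}(n)=-\frac{5}{24\alpha\beta}\sum_{\substack{\delta\mid\alpha\beta\\ \delta\ne\alpha,\beta}}X_\delta\,\sigma_3\bigl(\tfrac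 n\delta\bigr)+\frac{5}{24\alpha\beta}(\alpha^2-X_\alpha)\,\sigma_3\bigl(\tfrac n\alpha\bigr)+\frac{5}{24\alpha\beta}(\beta^2-X_\beta)\,\sigma_3\bigl(\tfrac n\beta\bigr)-\sum_{j=1}^{m_S}\frac{1}{1152\alpha\beta}Y_j\,\mathfrak{b}_j(n)+\Bigl(\frac1{24}-\frac{n}{4\beta}\Bigr)\sigma\bigl(\tfrac n\alpha\bigr)+\Bigl(\frac1{24}-\frac{n}{4\alpha}\Bigr)\sigma\bigl(\tfrac n\beta\bigr).$$
   Context: $\mathbb{N}$ is the set of positive integers, $\mathbb{N}_0=\mathbb{N}\cup\{0\}$. $\sigma_k(n)=\sum_{0<d\mid n}d^k$ for $n\in\mathbb{N}$, $\sigma=\sigma_1$, and $\sigma_k(m)=0$ for $m\notin\mathbb{N}$. $q=e^{2\pi i z}$ with $z$ in the upper half-plane. $L(q)=1-24\sum_{n\ge1}\sigma(n)q^n$, $M(q)=1+240\sum_{n\ge1}\sigma_3(n)q^n$, $\eta(z)=q^{1/24}\prod_{n\ge1}(1-q^n)$. $M_4(\Gamma_0(N))$ and $S_4(\Gamma_0(N))$ are the spaces of modular forms and cusp forms of weight 4 for $\Gamma_0(N)$. $W_{(\alpha,\beta)}(n)=\sum_{(l,m)\in\mathbb{N}_0^2,\ \alpha l+\beta m=n}\sigma(l)\sigma(m)$. *)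

theory Defs
  imports
    "HOL-Complex_Analysis.Complex_Analysis"
    "HOL-Computational_Algebra.Computational_Algebra"
    "HOL-Library.Function_Algebras"
begin

text \<open>The argument is real so that \<open>\<sigma>\<^sub>k (n / \<delta>)\<close> can be written literally; the value is
  0 at every argument that is not a positive integer (in particular at 0).\<close>
definition divisor_sigma :: "nat \<Rightarrow> real \<Rightarrow> nat" where
  "divisor_sigma k x =
     (if x \<in> \<nat> \<and> x \<noteq> 0 then \<Sum>d | d dvd nat \<lfloor>x\<rfloor>. d ^ k else 0)"

definition conv_W :: "nat \<Rightarrow> nat \<Rightarrow> nat \<Rightarrow> nat" where
  "conv_W \<alpha> \<beta> n =
     (\<Sum>(l, m) \<in> {(l, m). \<alpha> * l + \<beta> * m = n}.
        divisor_sigma 1 (real l) * divisor_sigma 1 (real m))"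

abbreviation upper_half_plane :: "complex set" where
  "upper_half_plane \<equiv> {z. Im z > 0}"

text \<open>Integer matrices \<open>(a b; c d)\<close> are represented by quadruples \<open>(a, b, c, d)\<close>.\<close>
definition SL2Z :: "(int \<times> int \<times> int \<times> int) set" where
  "SL2Z = {(a, b, c, d). a * d - b * c = 1}"

definition Gamma0 :: "nat \<Rightarrow> (int \<times> int \<times> int \<times> int) set" where
  "Gamma0 N = {(a, b, c, d) \<in> SL2Z. int N dvd c}"

definition slash :: "nat \<Rightarrow> (complex \<Rightarrow> complex) \<Rightarrow> int \<times> int \<times> int \<times> int \<Rightarrow> complex \<Rightarrow> complex"
  where
  "slash k f = (\<lambda>(a, b, c, d) z.
     f ((of_int a * z + of_int b) / (of_int c * z + of_int d)) / (of_int c * z + of_int d) ^ k)"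

definition nome :: "complex \<Rightarrow> complex" where
  "nome z = exp (2 * of_real pi * \<i> * z)"

text \<open>The local parameter at every cusp can be taken to be \<open>exp (2 \<pi> i z / N)\<close>, because
  \<open>\<Gamma>(N)\<close> is a normal subgroup of \<open>SL\<^sub>2(\<int>)\<close> contained in \<open>\<Gamma>\<^sub>0(N)\<close>.\<close>
definition has_cusp_expansion :: "nat \<Rightarrow> (complex \<Rightarrow> complex) \<Rightarrow> (nat \<Rightarrow> complex) \<Rightarrow> bool" where
  "has_cusp_expansion N g a \<longleftrightarrow>
     (\<forall>z \<in> upper_half_plane. (\<lambda>n. a n * nome (z / of_nat N) ^ n) sums g z)"

text \<open>A function on the upper half-plane is represented by a function on \<open>\<complex>\<close> that vanishes off
  the upper half-plane, so that equality of forms is equality of functions and linear algebra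
  over these spaces is meaningful.\<close>
definition modular_forms :: "nat \<Rightarrow> nat \<Rightarrow> (complex \<Rightarrow> complex) set" where
  "modular_forms k N = {f.
     (\<forall>z. z \<notin> upper_half_plane \<longrightarrow> f z = 0) \<and>
     f holomorphic_on upper_half_plane \<and>
     (\<forall>\<gamma> \<in> Gamma0 N. \<forall>z \<in> upper_half_plane. slash k f \<gamma> z = f z) \<and>
     (\<forall>\<gamma> \<in> SL2Z. \<exists>a. has_cusp_expansion N (slash k f \<gamma>) a)}"

definition cusp_forms :: "nat \<Rightarrow> nat \<Rightarrow> (complex \<Rightarrow> complex) set" where
  "cusp_forms k N = {f \<in> modular_forms k N.
     \<forall>\<gamma> \<in> SL2Z. \<exists>a. has_cusp_expansion N (slash k f \<gamma>) a \<and> a 0 = 0}"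

definition cscale :: "complex \<Rightarrow> (complex \<Rightarrow> complex) \<Rightarrow> complex \<Rightarrow> complex" where
  "cscale c f = (\<lambda>z. c * f z)"

global_interpretation cfun: vector_space cscale
  by unfold_locales (auto simp: cscale_def fun_eq_iff algebra_simps)

definition is_basis_of :: "(complex \<Rightarrow> complex) set \<Rightarrow> (complex \<Rightarrow> complex) set \<Rightarrow> bool" where
  "is_basis_of B V \<longleftrightarrow> cfun.independent B \<and> cfun.span B = V"

definition eis_L :: "complex \<Rightarrow> complex" where
  "eis_L q = 1 - 24 * (\<Sum>n. of_nat (divisor_sigma 1 (real (Suc n))) * q ^ Suc n)"

definition eis_M :: "complex \<Rightarrow> complex" where
  "eis_M q = 1 + 240 * (\<Sum>n. of_nat (divisor_sigma 3 (real (Suc n))) * q ^ Suc n)"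

definition eis_M_form :: "nat \<Rightarrow> complex \<Rightarrow> complex" where
  "eis_M_form t z = (if z \<in> upper_half_plane then eis_M (nome z ^ t) else 0)"

text \<open>The factor \<open>nome (z / 24)\<close> is \<open>q\<^bsup>1/24\<^esup>\<close>.\<close>
definition dedekind_eta :: "complex \<Rightarrow> complex" where
  "dedekind_eta z = nome (z / 24) * (\<Prod>n. 1 - nome z ^ Suc n)"

definition eta_quotient :: "nat \<Rightarrow> (nat \<Rightarrow> int) \<Rightarrow> complex \<Rightarrow> complex" where
  "eta_quotient N r z =
     (if z \<in> upper_half_plane
      then \<Prod>\<delta> | \<delta> dvd N. dedekind_eta (of_nat \<delta> * z) powi r \<delta> else 0)"

end

theory Submission
  imports Defs
begin

text \<open>
  Both sides of the hypothesis on \<open>X\<close> and \<open>Y\<close> are power series in \<open>q\<close> on the unit disc, so they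
  have the same coefficients, and the theorem is read off from the coefficient of \<open>q\<^sup>n\<close>. Put
  \<open>S\<^sub>d = \<Sum> \<sigma>(n/d) q\<^sup>n\<close>, so that \<open>L(q\<^sup>d) = 1 - 24 S\<^sub>d\<close>. Expanding the square
  \<open>(\<alpha> L(q\<^sup>\<alpha>) - \<beta> L(q\<^sup>\<beta>))\<^sup>2\<close> produces the three products \<open>S\<^sub>\<alpha>\<^sup>2\<close>, \<open>S\<^sub>\<beta>\<^sup>2\<close> and \<open>S\<^sub>\<alpha> S\<^sub>\<beta>\<close>. The
  coefficients of the mixed product are the numbers \<open>W\<^bsub>(\<alpha>,\<beta>)\<^esub>(n)\<close> that are wanted
  (\<open>sigma_fps_mult\<close>); those of the two squares are \<open>W\<^bsub>(\<alpha>,\<alpha>)\<^esub>(n)\<close> and \<open>W\<^bsub>(\<beta>,\<beta>)\<^esub>(n)\<close>, and have to be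
  eliminated. What remains is a linear equation for \<open>W\<^bsub>(\<alpha>,\<beta>)\<^esub>(n)\<close>.

  The elimination rests on the classical evaluation
  \<open>12 \<Sum>\<^bsub>l+m=n\<^esub> \<sigma>(l) \<sigma>(m) = 5 \<sigma>\<^sub>3(n) + (1 - 6 n) \<sigma>(n)\<close> (\<open>conv_W_1_1\<close>), which is equivalent to
  Ramanujan's \<open>L\<^sup>2 = M + 12 q dL/dq\<close>. It is obtained here by Liouville's elementary method,
  without modular forms: the sum is \<open>\<Sum> a b\<close> over the positive solutions of \<open>a x + b y = n\<close>, and
  \<open>4 a b = (a + b)\<^sup>2 - (a - b)\<^sup>2\<close>. For an even function \<open>F\<close> the sums of \<open>F(a - b)\<close> and of
  \<open>F(a + b)\<close> over these solutions are compared through the substitutions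
  \<open>a x + b y = (a - b) x + b (x + y)\<close> and \<open>a x + b y = a (x - y) + (a + b) y\<close>; all terms cancel
  except those on the diagonals \<open>a = b\<close> and \<open>x = y\<close>, which are divisor sums (\<open>liouville_identity\<close>).

  When \<open>\<alpha> = \<beta>\<close>, coprimality forces \<open>\<alpha> = \<beta> = 1\<close>, and then \<open>X \<alpha>\<close> and \<open>X \<beta>\<close> in the conclusion are the
  same number, counted twice. The formula survives because the constant coefficient
  gives \<open>X 1 = (\<alpha> - \<beta>)\<^sup>2 = 0\<close>.
\<close>

section \<open>Liouville's identity\<close>

definition reps :: "nat \<Rightarrow> (nat \<times> nat \<times> nat \<times> nat) set" where
  "reps n = {(a, x, b, y). 0 < a \<and> 0 < x \<and> 0 < b \<and> 0 < y \<and> a * x + b * y = n}"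

lemma finite_reps: "finite (reps n)"
proof (rule finite_subset)
  show "reps n \<subseteq> {..n} \<times> {..n} \<times> {..n} \<times> {..n}"
  proof (clarsimp simp: reps_def)
    fix a x b y :: nat
    assume "0 < a" "0 < x" "0 < b" "0 < y"
    then have "a * 1 \<le> a * x" "1 * x \<le> a * x" "b * 1 \<le> b * y" "1 * y \<le> b * y"
      by (intro mult_le_mono; simp)+
    then show "a \<le> a * x + b * y \<and> x \<le> a * x + b * y \<and> b \<le> a * x + b * y \<and> y \<le> a * x + b * y"
      by linarith
  qed
qed auto

lemma sum_trichotomy:
  fixes u v :: "'b \<Rightarrow> nat" and f :: "'b \<Rightarrow> 'a::comm_monoid_add"
  assumes "finite R"
  shows "sum f R = sum f {q \<in> R. u q < v q} + sum f {q \<in> R. v q < u q} + sum f {q \<in> R. u q = v q}"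
proof -
  have "R = {q \<in> R. u q < v q} \<union> {q \<in> R. v q < u q} \<union> {q \<in> R. u q = v q}"
    by auto
  then have "sum f R = sum f ({q \<in> R. u q < v q} \<union> {q \<in> R. v q < u q} \<union> {q \<in> R. u q = v q})"
    by simp
  also have "\<dots> = sum f ({q \<in> R. u q < v q} \<union> {q \<in> R. v q < u q}) + sum f {q \<in> R. u q = v q}"
    by (rule sum.union_disjoint) (use assms in auto)
  also have "sum f ({q \<in> R. u q < v q} \<union> {q \<in> R. v q < u q}) =
      sum f {q \<in> R. u q < v q} + sum f {q \<in> R. v q < u q}"
    by (rule sum.union_disjoint) (use assms in auto)
  finally show ?thesis .
qed

text \<open>For \<open>x = y\<close> the equation reads \<open>(a + b) x = n\<close>, so \<open>d = a + b\<close> runs through the divisors of \<open>n\<close>.\<close>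
lemma sum_reps_equal_cofactors:
  fixes h :: "nat \<Rightarrow> nat \<Rightarrow> 'a::comm_ring_1"
  assumes "0 < n"
  shows "(\<Sum>(a, x, b, y) \<in> {(a, x, b, y) \<in> reps n. x = y}. h a b) =
         (\<Sum>d | d dvd n. \<Sum>l = 1..<d. h l (d - l))"
proof -
  have "(\<Sum>(a, x, b, y) \<in> {(a, x, b, y) \<in> reps n. x = y}. h a b) =
        (\<Sum>(d, l) \<in> (SIGMA d:{d. d dvd n}. {1..<d}). h l (d - l))"
    by (rule sum.reindex_bij_witness
        [where i = "\<lambda>(d, l). (l, n div d, d - l, n div d)" and j = "\<lambda>(a, x, b, y). (a + b, a)"])
      (use assms in \<open>auto simp: reps_def simp flip: distrib_right elim!: dvdE\<close>)
  also have "\<dots> = (\<Sum>d | d dvd n. \<Sum>l = 1..<d. h l (d - l))"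
    by (rule sum.Sigma [symmetric]) (use assms in auto)
  finally show ?thesis .
qed

text \<open>For \<open>a = b\<close> it reads \<open>a (x + y) = n\<close>, and \<open>n/a\<close> splits into two positive parts in \<open>n/a - 1\<close> ways.\<close>
lemma sum_reps_equal_factors:
  fixes g :: "nat \<Rightarrow> 'a::comm_ring_1"
  assumes "0 < n"
  shows "(\<Sum>(a, x, b, y) \<in> {(a, x, b, y) \<in> reps n. a = b}. g a) =
         (\<Sum>d | d dvd n. of_nat (n div d - 1) * g d)"
proof -
  have "(\<Sum>(a, x, b, y) \<in> {(a, x, b, y) \<in> reps n. a = b}. g a) =
        (\<Sum>(d, l) \<in> (SIGMA d:{d. d dvd n}. {1..<n div d}). g d)"
    by (rule sum.reindex_bij_witness
        [where i = "\<lambda>(d, l). (d, l, d, n div d - l)" and j = "\<lambda>(a, x, b, y). (a, x)"])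
      (use assms in \<open>auto simp: reps_def simp flip: distrib_left elim!: dvdE\<close>)
  also have "\<dots> = (\<Sum>d | d dvd n. \<Sum>l = 1..<n div d. g d)"
    by (rule sum.Sigma [symmetric]) (use assms in auto)
  finally show ?thesis by simp
qed

text \<open>
  The shear \<open>(a, x, b, y) \<mapsto> (a, x + y, b - a, y)\<close> turns the solutions with \<open>a < b\<close> into those with
  \<open>x > y\<close> and makes the argument of \<open>F\<close> a coordinate. Exchanging the two products matches \<open>a > b\<close>
  with \<open>a < b\<close>; here evenness enters.
\<close>
lemma sum_reps_diff:
  fixes F :: "int \<Rightarrow> 'a::comm_ring_1"
  assumes "0 < n" and even_F: "\<And>t. F (- t) = F t"
  shows "(\<Sum>(a, x, b, y) \<in> reps n. F (int a - int b)) =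
         (\<Sum>d | d dvd n. of_nat (n div d - 1) * F 0) +
         2 * (\<Sum>(a, x, b, y) \<in> {(a, x, b, y) \<in> reps n. y < x}. F (int b))"
proof -
  let ?f = "\<lambda>(a, x, b, y). F (int a - int b)"
  have "sum ?f {(a, x, b, y) \<in> reps n. a < b} =
        (\<Sum>(a, x, b, y) \<in> {(a, x, b, y) \<in> reps n. y < x}. F (int b))"
    by (rule sum.reindex_bij_witness
        [where i = "\<lambda>(a, x, b, y). (a, x - y, a + b, y)" and j = "\<lambda>(a, x, b, y). (a, x + y, b - a, y)"])
      (auto simp: reps_def algebra_simps diff_mult_distrib2 diff_mult_distrib of_nat_diff
        intro!: le_add_diff_inverse trans_le_add1 mult_le_mono even_F [of "int _ - int _", simplified])
  moreover have "sum ?f {(a, x, b, y) \<in> reps n. b < a} = sum ?f {(a, x, b, y) \<in> reps n. a < b}"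
    by (rule sum.reindex_bij_witness
        [where i = "\<lambda>(a, x, b, y). (b, y, a, x)" and j = "\<lambda>(a, x, b, y). (b, y, a, x)"])
      (use even_F [of "int _ - int _"] in \<open>auto simp: reps_def\<close>)
  moreover have "sum ?f {(a, x, b, y) \<in> reps n. a = b} = (\<Sum>d | d dvd n. of_nat (n div d - 1) * F 0)"
    unfolding sum_reps_equal_factors [OF assms(1), symmetric] by (rule sum.cong) auto
  ultimately show ?thesis
    using sum_trichotomy [OF finite_reps [of n],
        of ?f "\<lambda>(a, x, b, y). a" "\<lambda>(a, x, b, y). b"]
    by (simp add: case_prod_unfold)
qed

text \<open>The inverse shear does the same for sums: \<open>a + b\<close> becomes a coordinate.\<close>
lemma sum_reps_add:
  fixes F :: "nat \<Rightarrow> 'a::comm_ring_1"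
  assumes "0 < n"
  shows "(\<Sum>(a, x, b, y) \<in> reps n. F (a + b)) =
         (\<Sum>d | d dvd n. of_nat (d - 1) * F d) +
         2 * (\<Sum>(a, x, b, y) \<in> {(a, x, b, y) \<in> reps n. a < b}. F b)"
proof -
  let ?f = "\<lambda>(a, x, b, y). F (a + b)"
  have "sum ?f {(a, x, b, y) \<in> reps n. y < x} =
        (\<Sum>(a, x, b, y) \<in> {(a, x, b, y) \<in> reps n. a < b}. F b)"
    by (rule sum.reindex_bij_witness
        [where j = "\<lambda>(a, x, b, y). (a, x - y, a + b, y)" and i = "\<lambda>(a, x, b, y). (a, x + y, b - a, y)"])
      (auto simp: reps_def algebra_simps diff_mult_distrib2 diff_mult_distrib of_nat_diff
        intro!: le_add_diff_inverse trans_le_add1 mult_le_mono)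
  moreover have "sum ?f {(a, x, b, y) \<in> reps n. x < y} = sum ?f {(a, x, b, y) \<in> reps n. y < x}"
    by (rule sum.reindex_bij_witness
        [where i = "\<lambda>(a, x, b, y). (b, y, a, x)" and j = "\<lambda>(a, x, b, y). (b, y, a, x)"])
      (auto simp: reps_def add.commute)
  moreover have "sum ?f {(a, x, b, y) \<in> reps n. x = y} = (\<Sum>d | d dvd n. of_nat (d - 1) * F d)"
    unfolding sum_reps_equal_cofactors [OF assms] by (rule sum.cong) auto
  ultimately show ?thesis
    using sum_trichotomy [OF finite_reps [of n],
        of ?f "\<lambda>(a, x, b, y). x" "\<lambda>(a, x, b, y). y"]
    by (simp add: case_prod_unfold)
qed

text \<open>
  The two sums left over by the preceding lemmas run over different regions. For a fixed \<open>b\<close> a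
  third shear \<open>(a, x, b, y) \<mapsto> (a - b, x, b, y + x)\<close> identifies the region \<open>b < a\<close> with \<open>x < y\<close>; so
  the complements \<open>x \<ge> y\<close> and \<open>a \<le> b\<close> carry the same total, and the two sums differ only by
  diagonal terms.
\<close>
lemma sum_reps_exchange:
  fixes G :: "nat \<Rightarrow> 'a::comm_ring_1"
  assumes "0 < n"
  shows "(\<Sum>(a, x, b, y) \<in> {(a, x, b, y) \<in> reps n. y < x}. G b) +
           (\<Sum>d | d dvd n. \<Sum>l = 1..<d. G l) =
         (\<Sum>(a, x, b, y) \<in> {(a, x, b, y) \<in> reps n. a < b}. G b) +
           (\<Sum>d | d dvd n. of_nat (n div d - 1) * G d)"
proof -
  let ?f = "\<lambda>(a, x, b, y). G b"
  have le: "v < u \<Longrightarrow> w * v \<le> u * w" for u v w :: nat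
    by (simp add: mult.commute)
  have shift: "sum ?f {(a, x, b, y) \<in> reps n. b < a} = sum ?f {(a, x, b, y) \<in> reps n. x < y}"
    by (rule sum.reindex_bij_witness
        [where j = "\<lambda>(a, x, b, y). (a - b, x, b, y + x)" and i = "\<lambda>(a, x, b, y). (a + b, x, b, y - x)"])
      (auto simp: reps_def algebra_simps diff_mult_distrib2 diff_mult_distrib
        intro!: le_add_diff_inverse trans_le_add1 le)
  have reflect: "(\<Sum>l = 1..<d. G (d - l)) = (\<Sum>l = 1..<d. G l)" for d
    by (rule sum.reindex_bij_witness [where i = "\<lambda>l. d - l" and j = "\<lambda>l. d - l"]) auto
  have swap: "sum ?f {(a, x, b, y) \<in> reps n. x = y} = (\<Sum>d | d dvd n. \<Sum>l = 1..<d. G l)"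
    unfolding sum_reps_equal_cofactors [OF assms, where h = "\<lambda>a b. G b"]
    by (simp only: reflect)
  have "sum ?f {(a, x, b, y) \<in> reps n. a = b} = (\<Sum>d | d dvd n. of_nat (n div d - 1) * G d)"
    unfolding sum_reps_equal_factors [OF assms, symmetric] by (rule sum.cong) auto
  then show ?thesis
    using sum_trichotomy [OF finite_reps [of n],
        of ?f "\<lambda>(a, x, b, y). x" "\<lambda>(a, x, b, y). y"]
      sum_trichotomy [OF finite_reps [of n],
        of ?f "\<lambda>(a, x, b, y). a" "\<lambda>(a, x, b, y). b"] shift swap
    by (simp add: case_prod_unfold add_ac)
qed

theorem liouville_identity:
  fixes F :: "int \<Rightarrow> 'a::comm_ring_1"
  assumes "0 < n" and even_F: "\<And>t. F (- t) = F t"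
  shows "(\<Sum>(a, x, b, y) \<in> reps n. F (int a - int b) - F (int a + int b)) =
         (\<Sum>d | d dvd n. of_nat (n div d - 1) * (F 0 + 2 * F (int d)) - of_nat (d - 1) * F (int d)
            - 2 * (\<Sum>l = 1..<d. F (int l)))"
proof -
  let ?D = "{d. d dvd n}"
  let ?U = "\<Sum>(a, x, b, y) \<in> {(a, x, b, y) \<in> reps n. y < x}. F (int b)"
  let ?V = "\<Sum>(a, x, b, y) \<in> {(a, x, b, y) \<in> reps n. a < b}. F (int b)"
  have "(\<Sum>(a, x, b, y) \<in> reps n. F (int a - int b) - F (int a + int b)) =
      (\<Sum>(a, x, b, y) \<in> reps n. F (int a - int b)) - (\<Sum>(a, x, b, y) \<in> reps n. F (int (a + b)))"
    by (simp add: case_prod_unfold sum_subtractf)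
  also have "\<dots> = (\<Sum>d \<in> ?D. of_nat (n div d - 1) * F 0) - (\<Sum>d \<in> ?D. of_nat (d - 1) * F (int d))
      + 2 * (?U - ?V)"
    using sum_reps_diff [where F = F, OF assms] sum_reps_add [OF assms(1), of "\<lambda>t. F (int t)"]
    by (simp add: algebra_simps)
  also have "?U - ?V = (\<Sum>d \<in> ?D. of_nat (n div d - 1) * F (int d)) - (\<Sum>d \<in> ?D. \<Sum>l = 1..<d. F (int l))"
    using sum_reps_exchange [OF assms(1), of "\<lambda>t. F (int t)"] by (simp add: algebra_simps)
  finally show ?thesis
    by (simp add: sum_subtractf sum.distrib sum_distrib_left algebra_simps)
qed

section \<open>The convolution of the divisor function with itself\<close>

lemma sum_squares_below: "6 * (\<Sum>l = 1..<d. (int l)\<^sup>2) = 2 * int d ^ 3 - 3 * (int d)\<^sup>2 + int d"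
  by (induction d) (auto simp: sum.atLeastLessThan_Suc algebra_simps power2_eq_square power3_eq_cube)

text \<open>Liouville's identity for \<open>F t = t\<^sup>2\<close>, since \<open>(a - b)\<^sup>2 - (a + b)\<^sup>2 = - 4 a b\<close>.\<close>
lemma sum_reps_mult:
  assumes "0 < n"
  shows "12 * (\<Sum>(a, x, b, y) \<in> reps n. int a * int b) =
         5 * (\<Sum>d | d dvd n. int d ^ 3) + (1 - 6 * int n) * (\<Sum>d | d dvd n. int d)"
proof -
  have "(\<Sum>(a, x, b, y) \<in> reps n. (int a - int b)\<^sup>2 - (int a + int b)\<^sup>2) =
        - 4 * (\<Sum>(a, x, b, y) \<in> reps n. int a * int b)"
    unfolding sum_distrib_left by (rule sum.cong) (auto simp: power2_eq_square algebra_simps)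
  then have "12 * (\<Sum>(a, x, b, y) \<in> reps n. int a * int b) =
      (\<Sum>d | d dvd n. - 3 * (of_nat (n div d - 1) * (0 + 2 * (int d)\<^sup>2) - of_nat (d - 1) * (int d)\<^sup>2
         - 2 * (\<Sum>l = 1..<d. (int l)\<^sup>2)))"
    using liouville_identity [OF assms, of "\<lambda>t. t\<^sup>2"] by (simp only: flip: sum_distrib_left) simp
  also have "\<dots> = (\<Sum>d | d dvd n. 5 * int d ^ 3 + (1 - 6 * int n) * int d)"
  proof (rule sum.cong)
    fix d assume "d \<in> {d. d dvd n}"
    then obtain e where e: "n = d * e" by auto
    with assms have "0 < d" "0 < e" by auto
    then show "- 3 * (of_nat (n div d - 1) * (0 + 2 * (int d)\<^sup>2) - of_nat (d - 1) * (int d)\<^sup>2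
         - 2 * (\<Sum>l = 1..<d. (int l)\<^sup>2)) = 5 * int d ^ 3 + (1 - 6 * int n) * int d"
      using sum_squares_below [of d]
      by (simp add: e of_nat_diff algebra_simps power2_eq_square power3_eq_cube)
  qed simp
  also have "\<dots> = 5 * (\<Sum>d | d dvd n. int d ^ 3) + (1 - 6 * int n) * (\<Sum>d | d dvd n. int d)"
    by (simp add: sum.distrib sum_distrib_left)
  finally show ?thesis .
qed

text \<open>At \<open>n = 0\<close> both sides are 0: every number divides 0, and a sum over an infinite set is 0.\<close>
lemma divisor_sigma_of_nat: "divisor_sigma k (real n) = (\<Sum>d | d dvd n. d ^ k)"
  by (auto simp: divisor_sigma_def)

lemma divisor_sigma_quotient:
  assumes "0 < d"
  shows "divisor_sigma k (real n / real d) = (if d dvd n then divisor_sigma k (real (n div d)) else 0)"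
proof (cases "d dvd n")
  case True
  then show ?thesis by (simp add: real_of_nat_div)
next
  case False
  have "real n / real d \<notin> \<nat>"
  proof
    assume "real n / real d \<in> \<nat>"
    then obtain m where "real n / real d = real m" by (auto elim: Nats_cases)
    then have "real n = real (m * d)" using assms by (simp add: field_simps)
    then have "n = m * d" by (simp only: of_nat_eq_iff)
    with False show False by simp
  qed
  with False show ?thesis by (simp add: divisor_sigma_def)
qed

text \<open>A solution of \<open>a x + b y = n\<close> is a decomposition \<open>n = l + m\<close> with divisors \<open>a\<close> of \<open>l\<close> and \<open>b\<close> of \<open>m\<close>.\<close>
lemma conv_W_1_1_eq_sum_reps:
  assumes "0 < n"
  shows "conv_W 1 1 n = (\<Sum>(a, x, b, y) \<in> reps n. a * b)"
proof -
  let ?P = "{(l, m). 0 < l \<and> 0 < m \<and> l + m = n}"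
  let ?D = "\<lambda>(l, m). {a. a dvd l} \<times> {b. b dvd m}"
  have fin: "finite {(l, m). l + m = n}"
    by (rule finite_subset [of _ "{..n} \<times> {..n}"]) auto
  have "conv_W 1 1 n = (\<Sum>(l, m) \<in> ?P. divisor_sigma 1 (real l) * divisor_sigma 1 (real m))"
    unfolding conv_W_def mult_1 by (rule sum.mono_neutral_right [OF fin]) (auto intro!: gr0I simp: divisor_sigma_def)
  also have "\<dots> = (\<Sum>p \<in> ?P. \<Sum>(a, b) \<in> ?D p. a * b)"
    by (rule sum.cong) (auto simp: divisor_sigma_of_nat sum_product sum.cartesian_product)
  also have "\<dots> = (\<Sum>(p, a, b) \<in> Sigma ?P ?D. a * b)"
    by (subst sum.Sigma) (auto intro: finite_subset [OF _ fin] simp: case_prod_unfold)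
  also have "\<dots> = (\<Sum>(a, x, b, y) \<in> reps n. a * b)"
    by (rule sum.reindex_bij_witness
        [where j = "\<lambda>((l, m), a, b). (a, l div a, b, m div b)" and
               i = "\<lambda>(a, x, b, y). ((a * x, b * y), a, b)"])
      (auto simp: reps_def)
  finally show ?thesis .
qed

lemma conv_W_1_1:
  assumes "0 < n"
  shows "12 * int (conv_W 1 1 n) =
         5 * int (divisor_sigma 3 (real n)) + (1 - 6 * int n) * int (divisor_sigma 1 (real n))"
  using sum_reps_mult [OF assms]
  unfolding conv_W_1_1_eq_sum_reps [OF assms] divisor_sigma_of_nat
  by (simp add: case_prod_unfold)

text \<open>If \<open>k\<close> divides \<open>n\<close>, dividing \<open>k l + k m = n\<close> by \<open>k\<close> reduces to \<open>k = 1\<close>; otherwise both sides vanish.\<close>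
lemma conv_W_diagonal:
  fixes n k :: nat
  assumes "0 < k" "0 < n"
  shows "12 * (of_nat (conv_W k k n) :: complex) =
         5 * of_nat (divisor_sigma 3 (real n / real k)) +
         (1 - 6 * of_nat n / of_nat k) * of_nat (divisor_sigma 1 (real n / real k))"
proof (cases "k dvd n")
  case False
  have "{(l, m). k * l + k * m = n} = {}"
    using False by (auto simp flip: distrib_left)
  with False assms show ?thesis by (simp add: conv_W_def divisor_sigma_quotient)
next
  case True
  then obtain m where m: "n = k * m" by auto
  with assms have "0 < m" by auto
  have "{(l, m'). k * l + k * m' = n} = {(l, m'). 1 * l + 1 * m' = m}"
    using assms by (auto simp: m simp flip: distrib_left)
  then have "conv_W k k n = conv_W 1 1 m" by (simp only: conv_W_def)
  moreover have "12 * (of_nat (conv_W 1 1 m) :: complex) =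
      5 * of_nat (divisor_sigma 3 (real m)) + (1 - 6 * of_nat m) * of_nat (divisor_sigma 1 (real m))"
    using arg_cong [OF conv_W_1_1 [OF \<open>0 < m\<close>], of "of_int :: int \<Rightarrow> complex"] by simp
  ultimately show ?thesis using assms by (simp add: m)
qed

section \<open>Power series of divisor functions\<close>

definition sigma_fps :: "nat \<Rightarrow> nat \<Rightarrow> complex fps" where
  "sigma_fps k d = Abs_fps (\<lambda>n. of_nat (divisor_sigma k (real n / real d)))"

lemma sigma_fps_mult:
  assumes "0 < \<alpha>" "0 < \<beta>"
  shows "sigma_fps 1 \<alpha> * sigma_fps 1 \<beta> = Abs_fps (\<lambda>n. of_nat (conv_W \<alpha> \<beta> n))"
proof (rule fps_ext)
  fix n
  let ?s = "\<lambda>d n. divisor_sigma 1 (real n / real d)"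
  have "(\<Sum>i = 0..n. ?s \<alpha> i * ?s \<beta> (n - i)) =
        (\<Sum>i \<in> {i \<in> {0..n}. \<alpha> dvd i \<and> \<beta> dvd n - i}. ?s \<alpha> i * ?s \<beta> (n - i))"
    by (rule sum.mono_neutral_right) (use assms in \<open>auto simp: divisor_sigma_quotient simp del: of_nat_diff\<close>)
  also have "\<dots> = conv_W \<alpha> \<beta> n"
    unfolding conv_W_def
    by (rule sum.reindex_bij_witness
        [where j = "\<lambda>i. (i div \<alpha>, (n - i) div \<beta>)" and i = "\<lambda>(l, m). \<alpha> * l"])
      (use assms in \<open>auto simp: divisor_sigma_quotient simp del: of_nat_diff\<close>)
  finally have "of_nat (\<Sum>i = 0..n. ?s \<alpha> i * ?s \<beta> (n - i)) = (of_nat (conv_W \<alpha> \<beta> n) :: complex)"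
    by simp
  then show "fps_nth (sigma_fps 1 \<alpha> * sigma_fps 1 \<beta>) n = fps_nth (Abs_fps (\<lambda>n. of_nat (conv_W \<alpha> \<beta> n))) n"
    by (simp add: sigma_fps_def fps_mult_nth)
qed

text \<open>A crude bound, for the convergence of the series on the whole open unit disc.\<close>
lemma divisor_sigma_quotient_le:
  assumes "0 < d"
  shows "divisor_sigma k (real n / real d) \<le> n ^ Suc k"
proof (cases "d dvd n \<and> n \<noteq> 0")
  case False
  with assms show ?thesis by (auto simp: divisor_sigma_quotient) (auto simp: divisor_sigma_def)
next
  case True
  let ?m = "n div d"
  from True have m: "0 < ?m" "?m \<le> n" by (auto simp: dvd_imp_le div_greater_zero_iff)
  have "(\<Sum>e | e dvd ?m. e ^ k) \<le> (\<Sum>e \<in> {1..?m}. ?m ^ k)"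
    using m by (intro sum_mono2 order_trans [OF sum_mono sum_mono2])
      (auto intro!: power_mono simp: dvd_imp_le)
  also have "\<dots> = ?m ^ Suc k" by simp
  also have "\<dots> \<le> n ^ Suc k" using m by (intro power_mono) auto
  finally show ?thesis using True assms by (simp add: divisor_sigma_quotient divisor_sigma_of_nat)
qed

lemma summable_sigma_fps:
  assumes "0 < d" "norm q < 1"
  shows "summable (\<lambda>n. fps_nth (sigma_fps k d) n * q ^ n)"
proof (rule summable_comparison_test')
  have "conv_radius (\<lambda>n. of_nat n ^ Suc k :: complex) = 1"
  proof (rule conv_radius_ratio_limit_nonzero)
    have "(\<lambda>n. (real n / real (Suc n)) ^ Suc k) \<longlonglongrightarrow> 1 ^ Suc k"
      by (intro tendsto_power LIMSEQ_n_over_Suc_n)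
    then show "(\<lambda>n. norm (of_nat n ^ Suc k :: complex) / norm (of_nat (Suc n) ^ Suc k :: complex)) \<longlonglongrightarrow> 1"
      by (simp only: norm_power norm_of_nat power_divide power_one)
  qed auto
  then show "summable (\<lambda>n. norm (of_nat n ^ Suc k * q ^ n))"
    using assms(2) by (intro abs_summable_in_conv_radius) (simp add: one_ereal_def)
  fix n
  have "real (divisor_sigma k (real n / real d)) \<le> real (n ^ Suc k)"
    using divisor_sigma_quotient_le [OF assms(1)] by (simp only: of_nat_le_iff)
  then show "norm (fps_nth (sigma_fps k d) n * q ^ n) \<le> norm (of_nat n ^ Suc k * q ^ n)"
    unfolding sigma_fps_def fps_nth_Abs_fps norm_mult norm_of_nat norm_power of_nat_power
    by (intro mult_right_mono) auto
qed

lemma fps_conv_radius_pos: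
  assumes "q \<noteq> 0" "summable (\<lambda>n. fps_nth F n * q ^ n)"
  shows "0 < fps_conv_radius F"
  using conv_radius_geI [OF assms(2)] assms(1)
  by (auto simp: fps_conv_radius_def intro: less_le_trans [of 0 "ereal (norm q)"])

lemma sigma_fps_has_fps_expansion:
  assumes "0 < d"
  shows "eval_fps (sigma_fps k d) has_fps_expansion sigma_fps k d"
  by (rule eval_fps_has_fps_expansion,
      rule fps_conv_radius_pos [OF _ summable_sigma_fps [OF assms, of "1/2"]]) auto

lemma eval_sigma_fps_rescale:
  assumes "0 < d" "norm q < 1"
  shows "eval_fps (sigma_fps k d) q = eval_fps (sigma_fps k 1) (q ^ d)"
proof -
  have "(\<lambda>n. fps_nth (sigma_fps k d) (d * n) * q ^ (d * n)) sums eval_fps (sigma_fps k d) q"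
    by (subst sums_mono_reindex [where g = "\<lambda>n. d * n"])
      (use assms summable_sigma_fps [OF assms] in
        \<open>auto simp: strict_mono_def sigma_fps_def divisor_sigma_quotient eval_fps_def summable_sums\<close>)
  then have "(\<lambda>n. fps_nth (sigma_fps k 1) n * (q ^ d) ^ n) sums eval_fps (sigma_fps k d) q"
    using assms(1) by (simp add: sigma_fps_def power_mult)
  then show ?thesis by (simp add: eval_fps_def sums_iff)
qed

lemma eis_L_rescale:
  assumes "0 < d" "norm q < 1"
  shows "eis_L (q ^ d) = 1 - 24 * eval_fps (sigma_fps 1 d) q"
proof -
  have "norm (q ^ d) < 1"
    using assms by (simp add: norm_power power_less_one_iff)
  from suminf_split_head [OF summable_sigma_fps [OF zero_less_one this, of 1]]
  show ?thesis
    unfolding eval_sigma_fps_rescale [OF assms] eis_L_def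
    by (simp add: eval_fps_def sigma_fps_def divisor_sigma_def [of _ 0])
qed

text \<open>
  The values of \<open>nome\<close> fill the unit disc except for its centre, so the identity theorem is needed in
  a form that does not look at 0.
\<close>
lemma has_fps_expansion_unique_punctured:
  fixes f g :: "complex \<Rightarrow> complex"
  assumes "f has_fps_expansion F" "g has_fps_expansion G" "eventually (\<lambda>q. f q = g q) (at 0)"
  shows "F = G"
proof -
  have "f has_laurent_expansion fps_to_fls F" "g has_laurent_expansion fps_to_fls G"
    using assms by (auto intro: has_laurent_expansion_fps)
  then have "fps_to_fls F = fps_to_fls G"
    using assms(3) has_laurent_expansion_cong has_laurent_expansion_unique by blast
  then show ?thesis by simp
qed

lemma nome_surj:
  assumes "q \<noteq> 0" "norm q < 1"
  obtains z where "z \<in> upper_half_plane" "nome z = q"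
proof
  let ?z = "Ln q / (2 * of_real pi * \<i>)"
  show "nome ?z = q" using assms by (simp add: nome_def)
  show "?z \<in> upper_half_plane"
    using assms by (simp add: Im_divide power2_eq_square divide_neg_pos)
qed

lemma norm_nome_less_1: "z \<in> upper_half_plane \<Longrightarrow> norm (nome z) < 1"
  by (simp add: nome_def norm_exp)

section \<open>Comparing coefficients\<close>

theorem theorem3p4:
  fixes \<alpha> \<beta> \<nu> mho m\<^sub>S :: nat
    and r :: "nat \<Rightarrow> nat \<Rightarrow> int"
    and \<bb> :: "nat \<Rightarrow> nat \<Rightarrow> complex"
    and X Y :: "nat \<Rightarrow> complex"
  assumes "0 < \<alpha>" and "\<alpha> \<le> \<beta>" and "coprime \<alpha> \<beta>"
    and "\<alpha> * \<beta> = 2 ^ \<nu> * mho" and "\<nu> \<in> {0, 1, 2, 3}"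
    and "0 < mho" and "odd mho" and "squarefree mho"
    and "m\<^sub>S = cfun.dim (cusp_forms 4 (\<alpha> * \<beta>))" and "0 < m\<^sub>S"
    and "\<And>j. j \<in> {1..m\<^sub>S} \<Longrightarrow> eta_quotient (\<alpha> * \<beta>) (r j) \<in> cusp_forms 4 (\<alpha> * \<beta>)"
    and "inj_on (\<lambda>j. eta_quotient (\<alpha> * \<beta>) (r j)) {1..m\<^sub>S}"
    and "is_basis_of
           (eis_M_form ` {t. t dvd \<alpha> * \<beta>} \<union> (\<lambda>j. eta_quotient (\<alpha> * \<beta>) (r j)) ` {1..m\<^sub>S})
           (modular_forms 4 (\<alpha> * \<beta>))"
    and "\<And>j z. j \<in> {1..m\<^sub>S} \<Longrightarrow> z \<in> upper_half_plane \<Longrightarrow>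
           (\<lambda>n. \<bb> j (Suc n) * nome z ^ Suc n) sums eta_quotient (\<alpha> * \<beta>) (r j) z"
    and "\<And>z q. z \<in> upper_half_plane \<Longrightarrow> q = nome z \<Longrightarrow>
           (of_nat \<alpha> * eis_L (q ^ \<alpha>) - of_nat \<beta> * eis_L (q ^ \<beta>))\<^sup>2 =
           (\<Sum>\<delta> | \<delta> dvd \<alpha> * \<beta>. X \<delta>) +
           (\<Sum>n. (240 * (\<Sum>\<delta> | \<delta> dvd \<alpha> * \<beta>.
                      of_nat (divisor_sigma 3 (real (Suc n) / real \<delta>)) * X \<delta>) +
                  (\<Sum>j = 1..m\<^sub>S. \<bb> j (Suc n) * Y j)) * q ^ Suc n)"
  shows "\<forall>n > 0. of_nat (conv_W \<alpha> \<beta> n) =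
    - (5 / (24 * of_nat \<alpha> * of_nat \<beta>)) *
        (\<Sum>\<delta> | \<delta> dvd \<alpha> * \<beta> \<and> \<delta> \<noteq> \<alpha> \<and> \<delta> \<noteq> \<beta>.
           X \<delta> * of_nat (divisor_sigma 3 (real n / real \<delta>)))
    + 5 / (24 * of_nat \<alpha> * of_nat \<beta>) * (of_nat \<alpha> ^ 2 - X \<alpha>) *
        of_nat (divisor_sigma 3 (real n / real \<alpha>))
    + 5 / (24 * of_nat \<alpha> * of_nat \<beta>) * (of_nat \<beta> ^ 2 - X \<beta>) *
        of_nat (divisor_sigma 3 (real n / real \<beta>))
    - (\<Sum>j = 1..m\<^sub>S. 1 / (1152 * of_nat \<alpha> * of_nat \<beta>) * Y j * \<bb> j n)
    + (1 / 24 - of_nat n / (4 * of_nat \<beta>)) * of_nat (divisor_sigma 1 (real n / real \<alpha>))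
    + (1 / 24 - of_nat n / (4 * of_nat \<alpha>)) * of_nat (divisor_sigma 1 (real n / real \<beta>))"
proof (intro allI impI)
  fix n :: nat
  assume "0 < n"
  let ?D = "{\<delta>. \<delta> dvd \<alpha> * \<beta>}"
  let ?s = "\<lambda>k d n. of_nat (divisor_sigma k (real n / real d)) :: complex"
  define a b where ab_def: "a = (of_nat \<alpha> :: complex)" "b = (of_nat \<beta> :: complex)"
  define SA SB where S_def: "SA = sigma_fps 1 \<alpha>" "SB = sigma_fps 1 \<beta>"
  have pos: "0 < \<alpha>" "0 < \<beta>" using assms(1,2) by auto
  then have nz: "a \<noteq> 0" "b \<noteq> 0" by (auto simp: ab_def)
  have finD: "finite ?D" using pos by simp

  \<comment> \<open>\<open>R\<close> is the expansion assumed for \<open>(\<alpha> L(q\<^sup>\<alpha>) - \<beta> L(q\<^sup>\<beta>))\<^sup>2\<close>; \<open>Lsq\<close> is the same square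
    multiplied out with \<open>L(q\<^sup>d) = 1 - 24 S\<^sub>d\<close>.\<close>
  define c where "c m = 240 * (\<Sum>\<delta> \<in> ?D. ?s 3 \<delta> m * X \<delta>) + (\<Sum>j = 1..m\<^sub>S. \<bb> j m * Y j)" for m
  define R where "R = Abs_fps (\<lambda>m. if m = 0 then \<Sum>\<delta> \<in> ?D. X \<delta> else c m)"
  define Lsq where "Lsq = fps_const ((a - b)\<^sup>2) - fps_const (48 * (a - b) * a) * SA
    + fps_const (48 * (a - b) * b) * SB + fps_const (576 * a\<^sup>2) * (SA * SA)
    + fps_const (576 * b\<^sup>2) * (SB * SB) - fps_const (1152 * a * b) * (SA * SB)"

  \<comment> \<open>An infinite sum asserts nothing about convergence, so equality of the sums is of no use until
    the series is known to converge.\<close>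
  have summable_R: "summable (\<lambda>m. fps_nth R m * nome z ^ m)" if z: "z \<in> upper_half_plane" for z
  proof (subst summable_Suc_iff [symmetric])
    have summable_s: "summable (\<lambda>m. ?s 3 \<delta> (Suc m) * nome z ^ Suc m)" if "\<delta> \<in> ?D" for \<delta>
    proof -
      have "0 < \<delta>" using that pos by (auto intro: dvd_pos_nat [rotated])
      from summable_sigma_fps [OF this norm_nome_less_1 [OF z], of 3]
      show "summable (\<lambda>m. ?s 3 \<delta> (Suc m) * nome z ^ Suc m)"
        by (subst summable_Suc_iff) (simp add: sigma_fps_def)
    qed
    have "summable (\<lambda>m. 240 * (\<Sum>\<delta> \<in> ?D. ?s 3 \<delta> (Suc m) * nome z ^ Suc m * X \<delta>)
        + (\<Sum>j = 1..m\<^sub>S. \<bb> j (Suc m) * nome z ^ Suc m * Y j))"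
      by (intro summable_add summable_mult summable_sum summable_mult2 summable_s
          sums_summable [OF assms(14) [OF _ z]])
    also have "(\<lambda>m. 240 * (\<Sum>\<delta> \<in> ?D. ?s 3 \<delta> (Suc m) * nome z ^ Suc m * X \<delta>)
        + (\<Sum>j = 1..m\<^sub>S. \<bb> j (Suc m) * nome z ^ Suc m * Y j)) = (\<lambda>m. fps_nth R (Suc m) * nome z ^ Suc m)"
      by (simp only: R_def c_def fps_nth_Abs_fps nat.distinct if_False distrib_left distrib_right
          sum_distrib_left sum_distrib_right mult_ac)
    finally show "summable (\<lambda>m. fps_nth R (Suc m) * nome z ^ Suc m)" .
  qed

  have eval_R: "(a * eis_L (nome z ^ \<alpha>) - b * eis_L (nome z ^ \<beta>))\<^sup>2 = eval_fps R (nome z)"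
    if z: "z \<in> upper_half_plane" for z
    using assms(15) [OF z refl] suminf_split_head [OF summable_R [OF z]]
    by (simp add: eval_fps_def R_def c_def ab_def)

  have "eval_fps R has_fps_expansion R"
  proof (intro eval_fps_has_fps_expansion fps_conv_radius_pos)
    show "nome \<i> \<noteq> 0" by (simp add: nome_def)
    show "summable (\<lambda>m. fps_nth R m * nome \<i> ^ m)" by (rule summable_R) simp
  qed
  moreover have "(\<lambda>q. (a - b)\<^sup>2 - 48 * (a - b) * a * eval_fps SA q + 48 * (a - b) * b * eval_fps SB q
      + 576 * a\<^sup>2 * (eval_fps SA q * eval_fps SA q) + 576 * b\<^sup>2 * (eval_fps SB q * eval_fps SB q)
      - 1152 * a * b * (eval_fps SA q * eval_fps SB q)) has_fps_expansion Lsq"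
    (is "?h has_fps_expansion _")
    unfolding Lsq_def S_def
    by (intro has_fps_expansion_diff has_fps_expansion_add has_fps_expansion_mult
        has_fps_expansion_const sigma_fps_has_fps_expansion pos)
  moreover have "eventually (\<lambda>q. ?h q = eval_fps R q) (at 0)"
  proof -
    have "?h q = eval_fps R q" if q: "q \<noteq> 0" "norm q < 1" for q
    proof -
      from q obtain z where z: "z \<in> upper_half_plane" "nome z = q" by (rule nome_surj)
      have "eval_fps R q = (a * (1 - 24 * eval_fps SA q) - b * (1 - 24 * eval_fps SB q))\<^sup>2"
        using eval_R [OF z(1)] by (simp add: z(2) eis_L_rescale pos q(2) S_def)
      then show ?thesis by (simp add: power2_eq_square algebra_simps)
    qed
    then show ?thesis
      by (auto simp: eventually_at intro!: exI [of _ 1])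
  qed
  ultimately have "Lsq = R"
    by (intro has_fps_expansion_unique_punctured [of ?h _ "eval_fps R"])
  then have nth: "fps_nth Lsq m = fps_nth R m" for m by simp

  have const: "(a - b)\<^sup>2 = (\<Sum>\<delta> \<in> ?D. X \<delta>)"
    using nth [of 0] by (simp add: Lsq_def R_def S_def sigma_fps_def divisor_sigma_def)

  define sa sb ta tb where s_def: "sa = ?s 1 \<alpha> n" "sb = ?s 1 \<beta> n" "ta = ?s 3 \<alpha> n" "tb = ?s 3 \<beta> n"
  define W where "W = (of_nat (conv_W \<alpha> \<beta> n) :: complex)"
  define B where "B = (\<Sum>j = 1..m\<^sub>S. \<bb> j n * Y j)"
  let ?D' = "{\<delta>. \<delta> dvd \<alpha> * \<beta> \<and> \<delta> \<noteq> \<alpha> \<and> \<delta> \<noteq> \<beta>}"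
  define T where "T = (\<Sum>\<delta> \<in> ?D'. X \<delta> * ?s 3 \<delta> n)"
  have diag: "12 * of_nat (conv_W \<alpha> \<alpha> n) = 5 * ta + (1 - 6 * of_nat n / a) * sa"
    "12 * of_nat (conv_W \<beta> \<beta> n) = 5 * tb + (1 - 6 * of_nat n / b) * sb"
    using pos \<open>0 < n\<close> by (simp_all only: conv_W_diagonal s_def ab_def)
  have nth_S: "fps_nth SA n = sa" "fps_nth SB n = sb"
    by (simp_all add: S_def s_def sigma_fps_def)
  have products: "SA * SA = Abs_fps (\<lambda>n. of_nat (conv_W \<alpha> \<alpha> n))"
    "SB * SB = Abs_fps (\<lambda>n. of_nat (conv_W \<beta> \<beta> n))"
    "SA * SB = Abs_fps (\<lambda>n. of_nat (conv_W \<alpha> \<beta> n))"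
    unfolding S_def by (intro sigma_fps_mult pos)+
  have "c n = - 48 * (a - b) * a * sa + 48 * (a - b) * b * sb + 48 * a\<^sup>2 * (12 * of_nat (conv_W \<alpha> \<alpha> n))
      + 48 * b\<^sup>2 * (12 * of_nat (conv_W \<beta> \<beta> n)) - 1152 * a * b * W"
    using nth [of n] \<open>0 < n\<close> by (simp add: Lsq_def R_def nth_S products W_def algebra_simps)
  also have "\<dots> = 240 * (a\<^sup>2 * ta + b\<^sup>2 * tb) + 48 * a * b * (sa + sb) - 288 * of_nat n * (a * sa + b * sb)
      - 1152 * a * b * W"
    unfolding diag using nz by (simp add: field_simps power2_eq_square)
  finally have coeff: "1152 * a * b * W = 240 * (a\<^sup>2 * ta + b\<^sup>2 * tb) + 48 * a * b * (sa + sb)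
      - 288 * of_nat n * (a * sa + b * sb) - c n"
    by (simp add: algebra_simps)

  have c_n: "c n = 240 * (T + X \<alpha> * ta + X \<beta> * tb) + B"
  proof (cases "\<alpha> = \<beta>")
    case False
    have "?D = insert \<alpha> (insert \<beta> ?D')" by auto
    then have "(\<Sum>\<delta> \<in> ?D. X \<delta> * ?s 3 \<delta> n) = X \<alpha> * ta + (X \<beta> * tb + T)"
      using False finD by (simp add: T_def s_def)
    then show ?thesis by (simp add: c_def B_def algebra_simps)
  next
    case True
    \<comment> \<open>The term of \<open>\<delta> = 1\<close> is counted once on the left and twice on the right.\<close>
    with assms(3) have "\<alpha> = 1" "\<beta> = 1" by auto
    moreover from this have "X 1 = 0" using const by (simp add: ab_def)
    ultimately show ?thesis by (simp add: c_def B_def T_def)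
  qed

  have sum_B: "(\<Sum>j = 1..m\<^sub>S. 1 / (1152 * of_nat \<alpha> * of_nat \<beta>) * Y j * \<bb> j n) = 1 / (1152 * a * b) * B"
    by (simp add: B_def ab_def sum_divide_distrib mult_ac)
  have "W = (240 * (a\<^sup>2 * ta + b\<^sup>2 * tb) + 48 * a * b * (sa + sb)
      - 288 * of_nat n * (a * sa + b * sb) - (240 * (T + X \<alpha> * ta + X \<beta> * tb) + B)) / (1152 * a * b)"
    unfolding c_n [symmetric] coeff [symmetric] using nz by simp
  also have "\<dots> = - (5 / (24 * a * b)) * T + 5 / (24 * a * b) * (a ^ 2 - X \<alpha>) * ta
      + 5 / (24 * a * b) * (b ^ 2 - X \<beta>) * tb - 1 / (1152 * a * b) * B
      + (1 / 24 - of_nat n / (4 * b)) * sa + (1 / 24 - of_nat n / (4 * a)) * sb"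
    using nz by (simp add: field_simps power2_eq_square)
  finally show "of_nat (conv_W \<alpha> \<beta> n) =
    - (5 / (24 * of_nat \<alpha> * of_nat \<beta>)) *
        (\<Sum>\<delta> | \<delta> dvd \<alpha> * \<beta> \<and> \<delta> \<noteq> \<alpha> \<and> \<delta> \<noteq> \<beta>.
           X \<delta> * of_nat (divisor_sigma 3 (real n / real \<delta>)))
    + 5 / (24 * of_nat \<alpha> * of_nat \<beta>) * (of_nat \<alpha> ^ 2 - X \<alpha>) *
        of_nat (divisor_sigma 3 (real n / real \<alpha>))
    + 5 / (24 * of_nat \<alpha> * of_nat \<beta>) * (of_nat \<beta> ^ 2 - X \<beta>) *
        of_nat (divisor_sigma 3 (real n / real \<beta>))
    - (\<Sum>j = 1..m\<^sub>S. 1 / (1152 * of_nat \<alpha> * of_nat \<beta>) * Y j * \<bb> j n)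
    + (1 / 24 - of_nat n / (4 * of_nat \<beta>)) * of_nat (divisor_sigma 1 (real n / real \<alpha>))
    + (1 / 24 - of_nat n / (4 * of_nat \<alpha>)) * of_nat (divisor_sigma 1 (real n / real \<beta>))"
    by (simp only: W_def T_def s_def ab_def sum_B)
qed

end
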